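(* Let $N$ be a 3-prime left near-ring and let $d : N \to N$ be a nonzero multiplicative derivation of $N$ such that $d([x,y]) = [d(x),y]$ for all $x,y \in N$. Then $N$ is a commutative ring.
   Context: A (left) near-ring is a set $N$ with two binary operations $+$ and $\cdot$ such that $(N,+)$ is a group (not assumed abelian, written additively with identity $0$), multiplication is associative, and $x(y+z) = xy + xz$ for all $x,y,z \in N$ (right distributivity and a multiplicative identity are not assumed). $N$ is 3-prime if, for $x,y \in N$, $xNy = \{0\}$ (i.e. $xny = 0$ for all $n \in N$) implies $x = 0$ or $y = 0$. For $x,y \in N$, $[x,y] = xy - yx$. A multiplicative derivation of $N$ is a map $d : N \to N$, not assumed additive, with $d(xy) = x d(y) + d(x) y$ for all $x,y \in N$; it is nonzero if it is not identically $0$. That $N$ is a commutative ring means that $(N,+)$ is abelian, multiplication is commutative, and both distributive laws hold (no identity is required). *)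

theory Defs
  imports Main
begin

text \<open>
  The additive group is not assumed abelian, and right distributivity and a multiplicative
  identity are not assumed. In particular \<open>0 * x = 0\<close> is not part of the axioms.
\<close>

class left_near_ring = group_add + semigroup_mult +
  assumes near_ring_distrib_left: "x * (y + z) = x * y + x * z"

definition three_prime :: "'a::left_near_ring itself \<Rightarrow> bool" where
  "three_prime _ \<longleftrightarrow>
     (\<forall>x y :: 'a. (\<forall>n. x * n * y = 0) \<longrightarrow> x = 0 \<or> y = 0)"

definition commutator :: "'a::left_near_ring \<Rightarrow> 'a \<Rightarrow> 'a" where
  "commutator x y = x * y - y * x"

definition multiplicative_derivation :: "('a::left_near_ring \<Rightarrow> 'a) \<Rightarrow> bool" where
  "multiplicative_derivation d \<longleftrightarrow> (\<forall>x y. d (x * y) = x * d y + d x * y)"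

end

theory Submission
  imports Defs
begin

text \<open>
  A multiplicative derivation forces \<open>0 * x = 0\<close>. Expanding \<open>d [x, x * y]\<close> in two ways gives
  \<open>d x * [x, y] = 0\<close>, hence \<open>d x * n * [x, z] = 0\<close> for all \<open>n\<close>, so by 3-primeness every \<open>x\<close> is
  either central or killed by \<open>d\<close>; in both cases \<open>d x\<close> is central. Fix \<open>a\<close> with \<open>d a \<noteq> 0\<close>. If
  \<open>d y = 0\<close>, then \<open>d (a * y) = d a * y\<close> is central, and cancelling the central element
  \<open>d a\<close> shows that \<open>y\<close> is central. So multiplication commutes, and expanding
  \<open>(x + y) * (d a + d a)\<close> in two ways gives commutativity of addition.
\<close>

lemma near_ring_mult_zero_right [simp]: "x * 0 = (0::'a::left_near_ring)"
proof -
  have "x * 0 + x * 0 = x * 0 + 0"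
    by (simp flip: near_ring_distrib_left)
  then show ?thesis
    by (simp only: add_left_cancel)
qed

lemma near_ring_mult_minus_right: "x * (- y) = - (x * y :: 'a::left_near_ring)"
  using near_ring_distrib_left[of x y "- y"] by (simp add: minus_unique)

lemma near_ring_mult_diff_right: "x * (y - z) = x * y - (x * z :: 'a::left_near_ring)"
  using near_ring_distrib_left[of x y "- z"] by (simp add: near_ring_mult_minus_right)

lemma commutator_eq_0_iff: "commutator x y = 0 \<longleftrightarrow> x * y = y * x"
  by (simp add: commutator_def)

lemma commutator_self [simp]: "commutator x x = 0"
  by (simp add: commutator_def)

lemma multiplicative_derivationD:
  "multiplicative_derivation d \<Longrightarrow> d (x * y) = x * d y + d x * y"
  by (simp add: multiplicative_derivation_def)

text \<open>Meant for \<open>c = 0 * y\<close>, which every left multiplication fixes because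
  \<open>x * 0 = 0\<close>. Multiplying \<open>d c = 0 * d c + c\<close> by \<open>0\<close> on the
  left, where \<open>0 * 0 = 0\<close>, gives \<open>0 * d c = 0 * d c + c\<close>.\<close>

lemma multiplicative_derivation_left_fixed_eq_0:
  fixes d :: "'a::left_near_ring \<Rightarrow> 'a"
    and c :: 'a
  assumes d: "multiplicative_derivation d" and fixed: "\<And>x. x * c = c"
  shows "c = 0"
proof -
  have "d c = 0 * d c + c"
    using multiplicative_derivationD[OF d, of 0 c] by (simp add: fixed)
  then have "0 * d c = 0 * (0 * d c + c)"
    by simp
  also have "\<dots> = 0 * d c + c"
    by (simp add: near_ring_distrib_left fixed flip: mult.assoc)
  finally show ?thesis
    by (metis add_left_cancel add.right_neutral)
qed

lemma multiplicative_derivation_mult_zero_left: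
  fixes d :: "'a::left_near_ring \<Rightarrow> 'a"
    and y :: 'a
  assumes "multiplicative_derivation d"
  shows "0 * y = 0"
proof (rule multiplicative_derivation_left_fixed_eq_0[OF assms])
  show "x * (0 * y) = 0 * y" for x
    using mult.assoc[of x 0 y] by simp
qed

lemma multiplicative_derivation_zero:
  fixes d :: "'a::left_near_ring \<Rightarrow> 'a"
  assumes "multiplicative_derivation d"
  shows "d 0 = 0"
  using multiplicative_derivationD[OF assms, of 0 0]
  by (simp add: multiplicative_derivation_mult_zero_left[OF assms])

lemma three_primeD:
  fixes x y :: "'a::left_near_ring"
  assumes "three_prime TYPE('a)" and "\<And>n. x * n * y = 0"
  shows "x = 0 \<or> y = 0"
  using assms by (auto simp: three_prime_def)

text \<open>Centrality moves \<open>z\<close> past \<open>n\<close>, so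
  \<open>z * n * (x - y) = n * (z * x - z * y) = 0\<close>. Only left distributivity enters.\<close>

lemma three_prime_central_cancel:
  fixes z x y :: "'a::left_near_ring"
  assumes prime: "three_prime TYPE('a)" and z: "\<And>n. z * n = n * z" "z \<noteq> 0"
    and eq: "z * x = z * y"
  shows "x = y"
proof -
  have "z * n * (x - y) = 0" for n
    using eq by (simp add: z(1)[of n] mult.assoc near_ring_mult_diff_right)
  then show ?thesis
    using three_primeD[OF prime] z(2) by fastforce
qed

lemma derivation_zero_or_central:
  fixes d :: "'a::left_near_ring \<Rightarrow> 'a"
  assumes prime: "three_prime TYPE('a)" and d: "multiplicative_derivation d"
    and comm: "\<And>x y. d (commutator x y) = commutator (d x) y"
  shows "d x = 0 \<or> (\<forall>z. x * z = z * x)"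
proof -
  \<comment> \<open>The hypothesis at \<open>y = x\<close> reads
    \<open>0 = d 0 = commutator (d x) x\<close>.\<close>
  have self: "d x * x = x * d x"
    using comm[of x x]
    by (simp add: multiplicative_derivation_zero[OF d] flip: commutator_eq_0_iff)
  have swap: "d x * (x * y) = d x * (y * x)" for y
  proof -
    \<comment> \<open>By \<open>self\<close>, the left factor \<open>x\<close> can be absorbed into
      the second argument. The product rule yields the same term plus
      \<open>d x * commutator x y\<close>, which therefore vanishes.\<close>
    have "x * commutator (d x) y = commutator (d x) (x * y)"
      by (simp add: commutator_def near_ring_mult_diff_right self flip: mult.assoc)
    also have "\<dots> = d (commutator x (x * y))"
      by (simp add: comm)
    also have "commutator x (x * y) = x * commutator x y"
      by (simp add: commutator_def near_ring_mult_diff_right mult.assoc)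
    also have "d \<dots> = x * d (commutator x y) + d x * commutator x y"
      by (rule multiplicative_derivationD[OF d])
    also have "\<dots> = x * commutator (d x) y + d x * commutator x y"
      by (simp add: comm)
    finally have "d x * commutator x y = 0"
      by (metis add_left_cancel add.right_neutral)
    then show ?thesis
      by (simp add: commutator_def near_ring_mult_diff_right)
  qed
  \<comment> \<open>Behind \<open>d x\<close>, the factor \<open>x\<close> may jump over any
    element: first back over \<open>n\<close>, then forward over \<open>n * z\<close>.\<close>
  have "d x * n * commutator x z = 0" for n z
  proof -
    have "d x * n * (x * z) = d x * (x * n) * z"
      using swap[of n] by (simp flip: mult.assoc)
    also have "\<dots> = d x * n * (z * x)"
      using swap[of "n * z"] by (simp add: mult.assoc)
    finally show ?thesis
      by (simp add: commutator_def near_ring_mult_diff_right)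
  qed
  then have "d x = 0 \<or> commutator x z = 0" for z
    using three_primeD[OF prime] by blast
  then show ?thesis
    by (auto simp: commutator_eq_0_iff)
qed

theorem theorem4:
  fixes d :: "'a::left_near_ring \<Rightarrow> 'a"
  assumes "three_prime TYPE('a)"
    and "multiplicative_derivation d"
    and "\<exists>x. d x \<noteq> 0"
    and "\<forall>x y. d (commutator x y) = commutator (d x) y"
  shows "class.comm_ring ((+) :: 'a \<Rightarrow> 'a \<Rightarrow> 'a) 0 (-) uminus (*)"
proof -
  note prime = assms(1) and d = assms(2)
  have comm: "d (commutator x y) = commutator (d x) y" for x y
    using assms(4) by blast
  note dichotomy = derivation_zero_or_central[OF prime d comm]
  have d_central: "d x * y = y * d x" for x y
  proof (cases "d x = 0")
    case True
    then show ?thesis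
      by (simp add: multiplicative_derivation_mult_zero_left[OF d])
  next
    \<comment> \<open>Now \<open>x\<close> is central, so
      \<open>commutator (d x) y = d 0 = 0\<close>.\<close>
    case False
    then have "commutator x y = 0"
      using dichotomy[of x] by (simp add: commutator_eq_0_iff)
    then show ?thesis
      using comm[of x y]
      by (simp add: multiplicative_derivation_zero[OF d] flip: commutator_eq_0_iff)
  qed
  obtain a where a: "d a \<noteq> 0"
    using assms(3) by blast
  note cancel = three_prime_central_cancel[OF prime d_central a]
  have mult_commute: "y * z = z * y" for y z :: 'a
  proof (cases "d y = 0")
    case True
    then have "d (a * y) = d a * y"
      by (simp add: multiplicative_derivationD[OF d])
    then have "d a * (y * z) = z * (d a * y)"
      using d_central[of "a * y" z] by (simp add: mult.assoc)
    also have "\<dots> = d a * (z * y)"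
      using d_central[of a z] by (simp flip: mult.assoc)
    finally show ?thesis
      by (rule cancel)
  next
    case False
    then show ?thesis
      using dichotomy[of y] by blast
  qed
  have distrib_right: "(x + y) * z = x * z + y * z" for x y z :: 'a
    using near_ring_distrib_left[of z x y] by (simp add: mult_commute)
  have add_commute: "x + y = y + x" for x y :: 'a
  proof -
    let ?w = "d a"
    \<comment> \<open>The two orders of expansion share their outer summands \<open>x * ?w\<close>
      and \<open>y * ?w\<close>; cancelling these swaps the middle pair, and then the central
      nonzero \<open>?w\<close> is cancelled.\<close>
    have "x * ?w + (y * ?w + x * ?w) + y * ?w = (x + y) * (?w + ?w)"
      by (simp only: near_ring_distrib_left distrib_right[of x y ?w] add.assoc)
    also have "\<dots> = x * ?w + (x * ?w + y * ?w) + y * ?w"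
      by (subst distrib_right) (simp only: near_ring_distrib_left add.assoc)
    finally have "y * ?w + x * ?w = x * ?w + y * ?w"
      by simp
    then have "?w * (x + y) = ?w * (y + x)"
      by (simp add: near_ring_distrib_left d_central[of a])
    then show ?thesis
      by (rule cancel)
  qed
  show ?thesis
    by unfold_locales
      (simp_all add: add.assoc mult.assoc add_commute mult_commute distrib_right
        near_ring_distrib_left)
qed

end
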